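(* Let $n\geq 1$ and $k\geq 3$ be integers, and let $H_{n,k}$ be the Hamming graph. Then $\dim_f(H_{n,k})=\frac{k}{2}$.
   Context: The Hamming graph $H_{n,k}$ has vertex set $\{(x_1,\ldots,x_n): 1\leq x_i\leq k\}$, two vertices being adjacent iff they differ in exactly one coordinate (equivalently, it is the cartesian product of $n$ copies of the complete graph $K_k$). For vertices $x,y$ of a connected graph $G$, $R\{x,y\}$ is the set of vertices $z$ with $d(x,z)\neq d(y,z)$. A resolving function of $G$ is $f:V(G)\to[0,1]$ with $\sum_{z\in R\{x,y\}}f(z)\geq 1$ for all distinct $x,y$; $\dim_f(G)$ is the minimum of $\sum_{v\in V(G)}f(v)$ over all resolving functions $f$. *)

theory Defs
  imports "Graph_Theory.Graph_Theory" "HOL-Library.FuncSet"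
begin

text \<open>
  Following \<^theory>\<open>Graph_Theory.Digraph\<close>, undirected graphs are symmetric digraphs.
  The vertices are the \<open>n\<close>-tuples with entries in \<open>{1..k}\<close>, encoded as extensional functions
  on \<open>{1..n}\<close>, so that distinct functions are distinct tuples.
\<close>

definition hamming_graph :: "nat \<Rightarrow> nat \<Rightarrow> (nat \<Rightarrow> nat) pair_pre_digraph" where
  "hamming_graph n k =
     \<lparr> pverts = {1..n} \<rightarrow>\<^sub>E {1..k},
       parcs = {(x, y). x \<in> {1..n} \<rightarrow>\<^sub>E {1..k} \<and> y \<in> {1..n} \<rightarrow>\<^sub>E {1..k}
                        \<and> (\<exists>!i. i \<in> {1..n} \<and> x i \<noteq> y i)} \<rparr>"

lemma pair_graph_hamming_graph: "pair_graph (hamming_graph n k)"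
proof -
  let ?V = "{1..n} \<rightarrow>\<^sub>E {1..k}"
  have fin: "finite ?V" by (simp add: finite_PiE)
  have sub: "parcs (hamming_graph n k) \<subseteq> ?V \<times> ?V"
    unfolding hamming_graph_def by (simp add: subset_iff)
  show ?thesis
  proof
    fix e assume e: "e \<in> parcs (hamming_graph n k)"
    have "e \<in> ?V \<times> ?V" by (rule subsetD[OF sub e])
    then show "fst e \<in> pverts (hamming_graph n k)" "snd e \<in> pverts (hamming_graph n k)"
      by (simp_all add: hamming_graph_def mem_Times_iff)
    from e have "\<exists>i. fst e i \<noteq> snd e i"
      unfolding hamming_graph_def by (simp add: case_prod_unfold) blast
    then show "fst e \<noteq> snd e" by metis
  next
    show "finite (pverts (hamming_graph n k))" using fin by (simp add: hamming_graph_def)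
    show "finite (parcs (hamming_graph n k))"
      by (rule finite_subset[OF sub finite_cartesian_product[OF fin fin]])
    show "symmetric (with_proj (hamming_graph n k))"
      unfolding symmetric_def with_proj_simps
      by (rule symI) (simp add: hamming_graph_def neq_commute)
  qed
qed

text \<open>
  Distance is the least number of arcs of a walk, i.e. the shortest-path value
  for the weight that is constantly 1. It is \<open>\<infinity>\<close> between different components.
\<close>

definition graph_dist :: "('a, 'b) pre_digraph \<Rightarrow> 'a \<Rightarrow> 'a \<Rightarrow> ereal" where
  "graph_dist G u v = wf_digraph.\<mu> G (\<lambda>_. 1) u v"

definition resolving_set :: "('a, 'b) pre_digraph \<Rightarrow> 'a \<Rightarrow> 'a \<Rightarrow> 'a set" where
  "resolving_set G x y = {z \<in> verts G. graph_dist G x z \<noteq> graph_dist G y z}"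

definition resolving_function :: "('a, 'b) pre_digraph \<Rightarrow> ('a \<Rightarrow> real) \<Rightarrow> bool" where
  "resolving_function G f \<longleftrightarrow>
     (\<forall>v \<in> verts G. 0 \<le> f v \<and> f v \<le> 1) \<and>
     (\<forall>x \<in> verts G. \<forall>y \<in> verts G. x \<noteq> y \<longrightarrow> (\<Sum>z \<in> resolving_set G x y. f z) \<ge> 1)"

text \<open>
  \<open>LEAST\<close> is a genuine minimum: a number is shown to be the value by exhibiting a resolving
  function of that total weight and bounding the weight of all others from below.
  The definition is meant for finite graphs.
\<close>

definition frac_metric_dim :: "('a, 'b) pre_digraph \<Rightarrow> real" where
  "frac_metric_dim G =
     (LEAST w. \<exists>f. resolving_function G f \<and> w = (\<Sum>v \<in> verts G. f v))"

end

theory Submission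
  imports Defs
begin

text \<open>
  Distance in the Hamming graph is the number of differing coordinates. Two vertices that differ
  only in coordinate \<open>1\<close>, with values \<open>a\<close> and \<open>b\<close> there, are resolved exactly by the vertices whose
  first coordinate is \<open>a\<close> or \<open>b\<close>; so the weights \<open>F a\<close> of the \<open>k\<close> layers satisfy \<open>F a + F b \<ge> 1\<close>
  pairwise, and the total weight is at least \<open>k / 2\<close>. Conversely, if \<open>x\<close> and \<open>y\<close> differ in coordinate
  \<open>i\<close> and \<open>k \<ge> 3\<close>, then every line in direction \<open>i\<close> contains at least two vertices resolving them,
  so \<open>2 * k ^ (n - 1)\<close> vertices do, and a constant function of total weight \<open>k / 2\<close> is resolving.
\<close>

section \<open>Hamming distance over an arbitrary set of coordinates\<close>

definition diff_count :: "'i set \<Rightarrow> ('i \<Rightarrow> 'a) \<Rightarrow> ('i \<Rightarrow> 'a) \<Rightarrow> nat" where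
  "diff_count I x y = card {i \<in> I. x i \<noteq> y i}"

lemma diff_count_triangle:
  assumes "finite I"
  shows "diff_count I x z \<le> diff_count I x y + diff_count I y z"
proof -
  have "diff_count I x z \<le> card ({i \<in> I. x i \<noteq> y i} \<union> {i \<in> I. y i \<noteq> z i})"
    unfolding diff_count_def using assms by (intro card_mono) auto
  also have "\<dots> \<le> diff_count I x y + diff_count I y z"
    unfolding diff_count_def by (rule card_Un_le)
  finally show ?thesis .
qed

lemma diff_count_eq_1:
  assumes "\<exists>!i. i \<in> I \<and> x i \<noteq> y i"
  shows "diff_count I x y = 1"
proof -
  from assms obtain i where "{i \<in> I. x i \<noteq> y i} = {i}" by blast
  then show ?thesis by (simp add: diff_count_def)
qed

text \<open>Splitting off one coordinate allows tuples to be compared along a line: when only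
  coordinate \<open>i\<close> varies, the first summand is constant and just the 0/1 term
  changes.\<close>

lemma diff_count_remove:
  assumes "finite I" "i \<in> I"
  shows "diff_count I x y = diff_count (I - {i}) x y + of_bool (x i \<noteq> y i)"
proof -
  have "{j \<in> I. x j \<noteq> y j} =
      {j \<in> I - {i}. x j \<noteq> y j} \<union> (if x i \<noteq> y i then {i} else {})"
    using assms by auto
  then show ?thesis
    using assms by (simp add: diff_count_def)
qed

lemma diff_count_cong:
  assumes "\<And>i. i \<in> I \<Longrightarrow> x i = x' i" "\<And>i. i \<in> I \<Longrightarrow> y i = y' i"
  shows "diff_count I x y = diff_count I x' y'"
proof -
  have "{i \<in> I. x i \<noteq> y i} = {i \<in> I. x' i \<noteq> y' i}" using assms by auto
  then show ?thesis by (simp add: diff_count_def)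
qed

section \<open>Graph distance equals Hamming distance\<close>

lemma pverts_hamming_graph: "pverts (hamming_graph n k) = {1..n} \<rightarrow>\<^sub>E {1..k}"
  by (simp add: hamming_graph_def)

lemma (in wf_digraph) awalk_cost_1: "awalk_cost (\<lambda>_. 1) p = real (length p)"
  by (induction p) auto

lemma diff_count_parcs_hamming_graph:
  assumes "e \<in> parcs (hamming_graph n k)"
  shows "diff_count {1..n} (fst e) (snd e) = 1"
  using assms unfolding hamming_graph_def
  by (intro diff_count_eq_1) (simp add: case_prod_unfold)

text \<open>Each arc changes exactly one coordinate, so the triangle inequality along the walk gives
  the bound.\<close>

lemma diff_count_le_length_awalk:
  assumes "pre_digraph.awalk (with_proj (hamming_graph n k)) x p y"
  shows "diff_count {1..n} x y \<le> length p"
proof -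
  interpret pair_graph "hamming_graph n k" by (rule pair_graph_hamming_graph)
  show ?thesis using assms
  proof (induction p arbitrary: x)
    case Nil
    then show ?case by (simp add: awalk_Nil_iff diff_count_def)
  next
    case (Cons e p)
    have "diff_count {1..n} (snd e) y \<le> length p"
      using Cons by (simp add: awalk_Cons_iff)
    moreover have "diff_count {1..n} x (snd e) = 1"
      using Cons.prems diff_count_parcs_hamming_graph by (auto simp: awalk_Cons_iff)
    ultimately show ?case
      using diff_count_triangle[of "{1..n}" x y "snd e"] by simp
  qed
qed

text \<open>The walk corrects one differing coordinate of \<open>x\<close> at a time to its value in
  \<open>y\<close>; each correction is an arc and lowers the Hamming distance by one.\<close>

lemma awalk_of_length_diff_count:
  assumes "x \<in> {1..n} \<rightarrow>\<^sub>E {1..k}" "y \<in> {1..n} \<rightarrow>\<^sub>E {1..k}"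
  shows "\<exists>p. pre_digraph.awalk (with_proj (hamming_graph n k)) x p y
    \<and> length p = diff_count {1..n} x y"
proof -
  interpret pair_graph "hamming_graph n k" by (rule pair_graph_hamming_graph)
  show ?thesis using assms
  proof (induction "diff_count {1..n} x y" arbitrary: x)
    case 0
    then have "x = y"
      by (intro PiE_ext[of x "{1..n}" "\<lambda>_. {1..k}" y]) (auto simp: diff_count_def)
    then have "awalk x [] y"
      using 0 by (simp add: awalk_Nil_iff pverts_hamming_graph)
    then show ?case using 0 by (metis list.size(3))
  next
    case (Suc d)
    then have "{i \<in> {1..n}. x i \<noteq> y i} \<noteq> {}"
      by (metis card.empty diff_count_def nat.distinct(1))
    then obtain i where i: "i \<in> {1..n}" "x i \<noteq> y i" by blast
    let ?x = "x(i := y i)"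
    have x': "?x \<in> {1..n} \<rightarrow>\<^sub>E {1..k}"
      using Suc.prems i by (auto simp: PiE_iff extensional_def)
    have "diff_count ({1..n} - {i}) ?x y = diff_count ({1..n} - {i}) x y"
      by (rule diff_count_cong) auto
    then have "d = diff_count {1..n} ?x y"
      using Suc(2) i diff_count_remove[of "{1..n}" i x y] diff_count_remove[of "{1..n}" i ?x y]
      by simp
    from Suc(1)[OF this x' Suc.prems(2)]
    obtain p where p: "awalk ?x p y" "length p = diff_count {1..n} ?x y" by blast
    have "(x, ?x) \<in> parcs (hamming_graph n k)"
      using Suc.prems x' i by (auto simp: hamming_graph_def)
    then have "awalk x ((x, ?x) # p) y"
      using p by (simp add: awalk_Cons_iff)
    then show ?case
      using p Suc(2) \<open>d = _\<close> by (metis length_Cons)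
  qed
qed

lemma graph_dist_hamming_graph:
  assumes "x \<in> {1..n} \<rightarrow>\<^sub>E {1..k}" "y \<in> {1..n} \<rightarrow>\<^sub>E {1..k}"
  shows "graph_dist (with_proj (hamming_graph n k)) x y = ereal (real (diff_count {1..n} x y))"
proof -
  interpret pair_graph "hamming_graph n k" by (rule pair_graph_hamming_graph)
  obtain p where p: "awalk x p y" "length p = diff_count {1..n} x y"
    using awalk_of_length_diff_count[OF assms] by blast
  show ?thesis
  proof (rule antisym)
    show "graph_dist (with_proj (hamming_graph n k)) x y \<le> ereal (real (diff_count {1..n} x y))"
      using min_cost_le_walk_cost[OF p(1), of "\<lambda>_. 1"] p(2)
      by (simp add: graph_dist_def awalk_cost_1)
    show "ereal (real (diff_count {1..n} x y)) \<le> graph_dist (with_proj (hamming_graph n k)) x y"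
      unfolding graph_dist_def \<mu>_def
      by (rule INF_greatest) (use diff_count_le_length_awalk in \<open>auto simp: awalk_cost_1\<close>)
  qed
qed

section \<open>Many resolving vertices and the upper bound\<close>

lemma resolving_set_hamming_graph:
  assumes "x \<in> {1..n} \<rightarrow>\<^sub>E {1..k}" "y \<in> {1..n} \<rightarrow>\<^sub>E {1..k}"
  shows "resolving_set (with_proj (hamming_graph n k)) x y =
    {z \<in> {1..n} \<rightarrow>\<^sub>E {1..k}. diff_count {1..n} x z \<noteq> diff_count {1..n} y z}"
  using assms by (auto simp: resolving_set_def graph_dist_hamming_graph pverts_hamming_graph)

lemma two_resolvers_on_line:
  assumes "finite I" "i \<in> I" "x i \<noteq> y i" "x i \<in> A" "y i \<in> A" "finite A" "card A \<ge> 3"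
  shows "card {c \<in> A. diff_count I x (g(i := c)) \<noteq> diff_count I y (g(i := c))} \<ge> 2"
proof -
  let ?B = "{c \<in> A. diff_count I x (g(i := c)) \<noteq> diff_count I y (g(i := c))}"
  \<comment> \<open>A third value \<open>c\<close>, different from both \<open>x i\<close> and
    \<open>y i\<close>, exists because \<open>A\<close> has at least three elements.\<close>
  have "card {x i, y i} < card A" using assms by simp
  then have "\<not> A \<subseteq> {x i, y i}" by (meson card_mono finite.emptyI finite.insertI not_le)
  then obtain c where c: "c \<in> A" "c \<noteq> x i" "c \<noteq> y i" by blast
  define a where "a = diff_count (I - {i}) x g"
  define b where "b = diff_count (I - {i}) y g"
  have line: "diff_count I z (g(i := e)) = diff_count (I - {i}) z g + of_bool (z i \<noteq> e)" for z e
  proof -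
    have "diff_count (I - {i}) z (g(i := e)) = diff_count (I - {i}) z g"
      by (rule diff_count_cong) auto
    then show ?thesis using diff_count_remove[OF assms(1,2), of z "g(i := e)"] by simp
  qed
  \<comment> \<open>Off coordinate \<open>i\<close> the distances are the constants \<open>a\<close>
    and \<open>b\<close>. If \<open>a < b\<close>, then \<open>x i\<close> gives \<open>a\<close>
    against \<open>b + 1\<close>, and \<open>c\<close> gives \<open>a + 1\<close> against
    \<open>b + 1\<close>; the value \<open>y i\<close> could fail, when \<open>b = a + 1\<close>.
    The case \<open>a > b\<close> is symmetric. If \<open>a = b\<close>, both \<open>x i\<close> and
    \<open>y i\<close> resolve.\<close>
  have "\<exists>e e'. e \<noteq> e' \<and> {e, e'} \<subseteq> ?B"
  proof (cases a b rule: linorder_cases)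
    case less
    then have "{x i, c} \<subseteq> ?B" "x i \<noteq> c"
      using c assms by (auto simp: line a_def b_def)
    then show ?thesis by blast
  next
    case equal
    then have "{x i, y i} \<subseteq> ?B"
      using assms by (auto simp: line a_def b_def)
    then show ?thesis using assms by blast
  next
    case greater
    then have "{y i, c} \<subseteq> ?B" "y i \<noteq> c"
      using c assms by (auto simp: line a_def b_def)
    then show ?thesis by blast
  qed
  then obtain e e' where "e \<noteq> e'" "{e, e'} \<subseteq> ?B" by blast
  then show ?thesis
    using card_mono[of ?B "{e, e'}"] assms by simp
qed

text \<open>The vertex set splits into \<open>k ^ (n - 1)\<close> disjoint lines in a direction
  \<open>i\<close> where \<open>x\<close> and \<open>y\<close> differ, and each line contributes at
  least two resolvers.\<close>

lemma card_resolving_set_hamming_graph: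
  assumes "x \<in> {1..n} \<rightarrow>\<^sub>E {1..k}" "y \<in> {1..n} \<rightarrow>\<^sub>E {1..k}" "x \<noteq> y" "k \<ge> 3"
  shows "2 * k ^ (n - 1) \<le> card (resolving_set (with_proj (hamming_graph n k)) x y)"
proof -
  let ?V = "{1..n} \<rightarrow>\<^sub>E {1..k}"
  let ?R = "{z \<in> ?V. diff_count {1..n} x z \<noteq> diff_count {1..n} y z}"
  obtain i where i: "i \<in> {1..n}" "x i \<noteq> y i"
    using PiE_ext[OF assms(1,2)] assms(3) by blast
  let ?W = "({1..n} - {i}) \<rightarrow>\<^sub>E {1..k}"
  let ?B = "\<lambda>g. {c \<in> {1..k}. diff_count {1..n} x (g(i := c)) \<noteq> diff_count {1..n} y (g(i := c))}"
  let ?\<phi> = "\<lambda>(g, c). g(i := c)"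
  have xy: "x i \<in> {1..k}" "y i \<in> {1..k}" using PiE_mem[OF assms(1)] PiE_mem[OF assms(2)] i by simp_all
  have finW: "finite ?W" by (simp add: finite_PiE)
  have finR: "finite ?R" by (simp add: finite_PiE)
  \<comment> \<open>A pair consists of a line, given by its coordinates \<open>g\<close> other than
    \<open>i\<close>, and a position \<open>c\<close> on it. Extensionality fixes \<open>g\<close>
    at \<open>i\<close>, so the resulting vertex determines both.\<close>
  have "inj_on ?\<phi> (Sigma ?W ?B)"
  proof (rule inj_onI, clarify)
    fix g c g' c' assume g: "g \<in> ?W" "g' \<in> ?W" and eq: "g(i := c) = g'(i := c')"
    have "g j = g' j" if "j \<in> {1..n} - {i}" for j
      using fun_cong[OF eq, of j] that by simp
    then have "g = g'" by (rule PiE_ext[OF g])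
    moreover have "c = c'" using fun_cong[OF eq, of i] by simp
    ultimately show "g = g' \<and> c = c'" by simp
  qed
  moreover have "?\<phi> ` Sigma ?W ?B \<subseteq> ?R"
  proof clarify
    fix g c assume "g \<in> ?W" "c \<in> {1..k}"
    then show "g(i := c) \<in> ?V"
      using PiE_fun_upd[of c "\<lambda>_. {1..k}" i g "{1..n} - {i}"] i by (simp add: insert_absorb)
  qed
  ultimately have "card (Sigma ?W ?B) \<le> card ?R"
    using finR by (rule card_inj_on_le)
  moreover have "card (Sigma ?W ?B) = (\<Sum>g\<in>?W. card (?B g))"
    using finW by (intro card_SigmaI) auto
  moreover have "(\<Sum>g\<in>?W. 2) \<le> (\<Sum>g\<in>?W. card (?B g))"
    by (intro sum_mono two_resolvers_on_line[where x = x and y = y, OF _ i xy]) (use assms(4) in simp_all)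
  moreover have "card ?W = k ^ (n - 1)"
    using i by (simp add: card_PiE)
  ultimately have "2 * k ^ (n - 1) \<le> card ?R" by simp
  then show ?thesis
    by (simp only: resolving_set_hamming_graph[OF assms(1,2)])
qed

text \<open>The constant is the reciprocal of the guaranteed number of resolvers, so its sum over
  every resolving set of two distinct vertices is at least 1.\<close>

lemma resolving_function_hamming_graph_const:
  assumes "k \<ge> 3"
  shows "resolving_function (with_proj (hamming_graph n k)) (\<lambda>_. 1 / (2 * real k ^ (n - 1)))"
proof -
  have pos: "real k ^ (n - 1) \<ge> 1" using assms by simp
  have "1 \<le> real (card (resolving_set (with_proj (hamming_graph n k)) x y)) / (2 * real k ^ (n - 1))"
    if "x \<in> {1..n} \<rightarrow>\<^sub>E {1..k}" "y \<in> {1..n} \<rightarrow>\<^sub>E {1..k}" "x \<noteq> y" for x y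
  proof -
    have "real (2 * k ^ (n - 1)) \<le> real (card (resolving_set (with_proj (hamming_graph n k)) x y))"
      using card_resolving_set_hamming_graph[OF that assms] of_nat_le_iff by blast
    then show ?thesis using assms by (simp add: le_divide_eq)
  qed
  then show ?thesis
    using pos by (simp add: resolving_function_def pverts_hamming_graph divide_le_eq)
qed

section \<open>Lower bound on the weight\<close>

lemma sum_ge_half_card_if_pairwise:
  fixes F :: "'a \<Rightarrow> real"
  assumes "finite A" "card A \<ge> 2"
    and pair: "\<And>a b. a \<in> A \<Longrightarrow> b \<in> A \<Longrightarrow> a \<noteq> b \<Longrightarrow> F a + F b \<ge> 1"
  shows "real (card A) / 2 \<le> sum F A"
proof (cases "\<forall>a\<in>A. F a \<ge> 1 / 2")
  case True
  then have "(\<Sum>a\<in>A. 1 / 2) \<le> sum F A" by (intro sum_mono) auto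
  then show ?thesis by simp
next
  case False
  \<comment> \<open>Only one value can lie below \<open>1 / 2\<close>. Pairing \<open>a\<close> with
    any other element \<open>b\<close> contributes at least 1, and each remaining value exceeds
    \<open>1 / 2\<close> since its sum with \<open>F a\<close> is at least 1.\<close>
  then obtain a where a: "a \<in> A" "F a < 1 / 2" by auto
  have "card {a} < card A" using assms by simp
  then have "\<not> A \<subseteq> {a}" by (meson card_mono finite.emptyI finite.insertI not_le)
  then obtain b where b: "b \<in> A" "b \<noteq> a" by blast
  have "(\<Sum>c\<in>A - {a, b}. 1 / 2) \<le> sum F (A - {a, b})"
  proof (rule sum_mono)
    fix c assume "c \<in> A - {a, b}"
    then show "1 / 2 \<le> F c" using pair[of a c] a by auto
  qed
  moreover have "card (A - {a, b}) = card A - 2"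
    using a b by (simp add: card_Diff_subset)
  moreover have "sum F A = F a + F b + sum F (A - {a, b})"
    using sum.subset_diff[of "{a, b}" A F] a b assms(1) by simp
  ultimately show ?thesis
    using pair[of a b] a b assms(2) by (simp add: of_nat_diff field_simps)
qed

lemma weight_ge_of_resolving_function_hamming_graph:
  assumes "n \<ge> 1" "k \<ge> 2"
    and res: "resolving_function (with_proj (hamming_graph n k)) f"
  shows "real k / 2 \<le> (\<Sum>v\<in>{1..n} \<rightarrow>\<^sub>E {1..k}. f v)"
proof -
  let ?V = "{1..n} \<rightarrow>\<^sub>E {1..k}"
  define L where "L a = {z \<in> ?V. z 1 = a}" for a
  have finV: "finite ?V" by (simp add: finite_PiE)
  have f0: "f v \<ge> 0" if "v \<in> ?V" for v
    using res that by (simp add: resolving_function_def pverts_hamming_graph)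
  have "1 \<le> sum f (L a) + sum f (L b)" if ab: "a \<in> {1..k}" "b \<in> {1..k}" "a \<noteq> b" for a b
  proof -
    \<comment> \<open>Two such vertices \<open>x a\<close> and \<open>x b\<close> differ only in the
      first coordinate; the filler 1 is a legal entry.\<close>
    define x where "x c = (\<lambda>i\<in>{1..n}. if i = 1 then c else (1::nat))" for c
    have xV: "x a \<in> ?V" "x b \<in> ?V" using ab assms by (auto simp: x_def)
    have x1: "x c 1 = c" for c using assms by (simp add: x_def)
    have "x a \<noteq> x b" using ab x1[of a] x1[of b] by auto
    let ?R = "resolving_set (with_proj (hamming_graph n k)) (x a) (x b)"
    \<comment> \<open>Outside both layers the first coordinate adds 1 to each distance, and the
      other coordinates contribute equally, so the distances agree.\<close>
    have "?R \<subseteq> L a \<union> L b"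
    proof
      fix z assume z: "z \<in> ?R"
      have line: "diff_count {1..n} (x c) z =
          diff_count ({1..n} - {1}) (x c) z + of_bool (c \<noteq> z 1)" for c
        using assms(1) diff_count_remove[of "{1..n}" 1 "x c" z] by (simp only: x1) simp
      have rest: "diff_count ({1..n} - {1}) (x a) z = diff_count ({1..n} - {1}) (x b) z"
        by (rule diff_count_cong) (auto simp: x_def)
      have "diff_count {1..n} (x a) z \<noteq> diff_count {1..n} (x b) z"
        using z unfolding resolving_set_hamming_graph[OF xV] by blast
      then have "a = z 1 \<or> b = z 1"
        unfolding line rest by (cases "a = z 1"; cases "b = z 1") simp_all
      then show "z \<in> L a \<union> L b"
        using z by (auto simp: L_def resolving_set_hamming_graph[OF xV])
    qed
    \<comment> \<open>Nonnegativity of \<open>f\<close> allows the sum to be enlarged to the two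
      layers.\<close>
    then have "sum f ?R \<le> sum f (L a \<union> L b)"
      using finV f0 by (intro sum_mono2) (auto simp: L_def)
    also have "\<dots> = sum f (L a) + sum f (L b)"
      using ab finV by (intro sum.union_disjoint) (auto simp: L_def)
    finally show ?thesis
      using res xV \<open>x a \<noteq> x b\<close> unfolding resolving_function_def
      by (fastforce simp: pverts_hamming_graph)
  qed
  then have "real (card {1..k}) / 2 \<le> (\<Sum>a\<in>{1..k}. sum f (L a))"
    using assms by (intro sum_ge_half_card_if_pairwise) auto
  \<comment> \<open>The layers partition the vertices by their first coordinate, which exists as
    \<open>n \<ge> 1\<close>.\<close>
  also have "\<dots> = sum f ?V"
    unfolding L_def using assms finV by (intro sum.group) auto
  finally show ?thesis by simp
qed

theorem theorem2p5:
  fixes n k :: nat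
  assumes "n \<ge> 1" and "k \<ge> 3"
  shows "frac_metric_dim (with_proj (hamming_graph n k)) = real k / 2"
  unfolding frac_metric_dim_def
proof (rule Least_equality)
  let ?f = "\<lambda>_ :: nat \<Rightarrow> nat. 1 / (2 * real k ^ (n - 1))"
  \<comment> \<open>With \<open>n \<ge> 1\<close> the subtraction \<open>n - 1\<close> is not
    truncated, so \<open>k ^ n\<close> vertices of equal weight give total
    \<open>k / 2\<close>.\<close>
  have "real k ^ n = real k * real k ^ (n - 1)"
    using assms(1) by (simp add: power_eq_if)
  then have w: "(\<Sum>v\<in>verts (with_proj (hamming_graph n k)). ?f v) = real k / 2"
    using assms by (simp add: pverts_hamming_graph card_PiE)
  show "\<exists>f. resolving_function (with_proj (hamming_graph n k)) f \<and>
      real k / 2 = (\<Sum>v\<in>verts (with_proj (hamming_graph n k)). f v)"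
    by (intro exI[of _ ?f] conjI resolving_function_hamming_graph_const[OF assms(2)] w[symmetric])
next
  fix w
  assume "\<exists>f. resolving_function (with_proj (hamming_graph n k)) f \<and>
    w = (\<Sum>v\<in>verts (with_proj (hamming_graph n k)). f v)"
  then show "real k / 2 \<le> w"
    using weight_ge_of_resolving_function_hamming_graph[of n k] assms
    by (auto simp: pverts_hamming_graph)
qed

end
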